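(* Let $\mathbb{N}'_1=\{3+6i : i=0,1,2,\dots\}$, $\mathbb{N}'_2=\{5+6j : j=0,1,2,\dots\}$ and $\mathbb{N}'_3=\{7+6k : k=0,1,2,\dots\}$. Let $n\geq 3$ be odd and let $H_{1,n}$ be the helm graph. Then $$\zeta(H_{1,n})=\begin{cases} 9, & \text{if } n=3,\\ \dfrac{3n(n-1)}{2}, & \text{if } n\in \mathbb{N}'_1\setminus\{3\} \text{ or } n\in\mathbb{N}'_2 \text{ or } n\in\mathbb{N}'_3.\end{cases}$$
   Context: All graphs are finite and simple. A proper vertex colouring assigns colours to vertices so that adjacent vertices receive different colours; $\chi(G)$ is the chromatic number of $G$. A chromatic colouring of $G$ is a proper vertex colouring using exactly $\chi(G)$ colours. With respect to a colouring $c$, an edge $uv$ is bad if $c(u)=c(v)$. The chromatic completion number $\zeta(G)$ is the maximum, over all chromatic colourings of $G$, of the number of edges (between distinct non-adjacent vertices of $G$) that can be added to $G$ without adding a bad edge with respect to that colouring, keeping the graph simple. The wheel graph $W_{1,n}$, $n\geq 3$, is the join $C_n+K_1$ of the cycle $C_n$ with vertices $v_1,\dots,v_n$ (the rim vertices) and a single central vertex adjacent to all rim vertices. The helm graph $H_{1,n}$, $n\geq 3$, is obtained from $W_{1,n}$ by adding, for each rim vertex $v_i$, $1\leq i\leq n$, one new pendant vertex $u_i$ adjacent only to $v_i$. *)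

theory Defs imports Complex_Main begin

type_synonym 'a graph = "'a set \<times> 'a set set"

abbreviation verts :: "'a graph \<Rightarrow> 'a set" where
  "verts G \<equiv> fst G"

abbreviation edges :: "'a graph \<Rightarrow> 'a set set" where
  "edges G \<equiv> snd G"

definition simple_graph :: "'a graph \<Rightarrow> bool" where
  "simple_graph G \<longleftrightarrow>
     finite (verts G) \<and> (\<forall>e\<in>edges G. \<exists>u\<in>verts G. \<exists>v\<in>verts G. u \<noteq> v \<and> e = {u, v})"

definition bad_edge :: "('a \<Rightarrow> nat) \<Rightarrow> 'a set \<Rightarrow> bool" where
  "bad_edge c e \<longleftrightarrow> (\<exists>u v. e = {u, v} \<and> c u = c v)"

definition proper_colouring :: "'a graph \<Rightarrow> ('a \<Rightarrow> nat) \<Rightarrow> bool" where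
  "proper_colouring G c \<longleftrightarrow> (\<forall>u v. {u, v} \<in> edges G \<longrightarrow> c u \<noteq> c v)"

definition chromatic_number :: "'a graph \<Rightarrow> nat" where
  "chromatic_number G = (LEAST k. \<exists>c. proper_colouring G c \<and> card (c ` verts G) = k)"

definition chromatic_colouring :: "'a graph \<Rightarrow> ('a \<Rightarrow> nat) \<Rightarrow> bool" where
  "chromatic_colouring G c \<longleftrightarrow>
     proper_colouring G c \<and> card (c ` verts G) = chromatic_number G"

definition addable :: "'a graph \<Rightarrow> ('a \<Rightarrow> nat) \<Rightarrow> 'a set set \<Rightarrow> bool" where
  "addable G c F \<longleftrightarrow>
     F \<inter> edges G = {} \<and> simple_graph (verts G, edges G \<union> F) \<and> (\<forall>e\<in>F. \<not> bad_edge c e)"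

text \<open>For a finite simple graph the set below is finite and nonempty, so \<open>Max\<close> is meaningful.\<close>
definition chromatic_completion_number :: "'a graph \<Rightarrow> nat" where
  "chromatic_completion_number G =
     Max {card F |c F. chromatic_colouring G c \<and> addable G c F}"

text \<open>Only used for graphs with disjoint vertex sets.\<close>
definition join :: "'a graph \<Rightarrow> 'a graph \<Rightarrow> 'a graph" where
  "join G H =
     (verts G \<union> verts H, edges G \<union> edges H \<union> {{u, v} |u v. u \<in> verts G \<and> v \<in> verts H})"

text \<open>\<open>Rim i\<close> is \<open>v\<^sub>i\<close> and \<open>Pendant i\<close> is \<open>u\<^sub>i\<close>, with indices \<open>1, \<dots>, n\<close>.\<close>
datatype helm_vertex = Centre | Rim nat | Pendant nat

definition rim_cycle :: "nat \<Rightarrow> helm_vertex graph" where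
  "rim_cycle n =
     (Rim ` {1..n}, {{Rim i, Rim (i + 1)} |i. 1 \<le> i \<and> i < n} \<union> {{Rim n, Rim 1}})"

definition centre_K1 :: "helm_vertex graph" where
  "centre_K1 = ({Centre}, {})"

definition wheel :: "nat \<Rightarrow> helm_vertex graph" where
  "wheel n = join (rim_cycle n) centre_K1"

definition helm :: "nat \<Rightarrow> helm_vertex graph" where
  "helm n =
     (verts (wheel n) \<union> Pendant ` {1..n},
      edges (wheel n) \<union> {{Rim i, Pendant i} |i. i \<in> {1..n}})"

lemma verts_helm: "verts (helm n) = insert Centre (Rim ` {1..n} \<union> Pendant ` {1..n})"
  unfolding helm_def wheel_def join_def rim_cycle_def centre_K1_def fst_conv by blast

lemma edges_helm:
  "edges (helm n) = {{Rim i, Rim (i + 1)} |i. 1 \<le> i \<and> i < n} \<union> {{Rim n, Rim 1}}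
     \<union> {{Rim i, Centre} |i. i \<in> {1..n}} \<union> {{Rim i, Pendant i} |i. i \<in> {1..n}}"
proof -
  have "{{u, v} |u v. u \<in> Rim ` {1..n} \<and> v \<in> {Centre}} = {{Rim i, Centre} |i. i \<in> {1..n}}"
    by blast
  then show ?thesis
    unfolding helm_def wheel_def join_def rim_cycle_def centre_K1_def fst_conv snd_conv Un_empty_right
    by (rule arg_cong)
qed

lemma simple_graph_helm:
  assumes "n \<ge> 3"
  shows "simple_graph (helm n)"
  unfolding simple_graph_def
proof (intro conjI ballI)
  show "finite (verts (helm n))"
    unfolding verts_helm by simp
next
  fix e assume "e \<in> edges (helm n)"
  then consider i where "1 \<le> i" "i < n" "e = {Rim i, Rim (i + 1)}" | "e = {Rim n, Rim 1}"
    | i where "i \<in> {1..n}" "e = {Rim i, Centre}" | i where "i \<in> {1..n}" "e = {Rim i, Pendant i}"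
    unfolding edges_helm by blast
  then have "\<exists>u v. u \<in> verts (helm n) \<and> v \<in> verts (helm n) \<and> u \<noteq> v \<and> e = {u, v}"
  proof cases
    case (1 i)
    then have "Rim i \<in> verts (helm n)" "Rim (i + 1) \<in> verts (helm n)" "Rim i \<noteq> Rim (i + 1)"
      by (simp_all add: verts_helm image_iff)
    with 1(3) show ?thesis by blast
  next
    case 2
    have "Rim n \<in> verts (helm n)" "Rim 1 \<in> verts (helm n)" "Rim n \<noteq> Rim 1"
      using assms by (simp_all add: verts_helm image_iff)
    with 2 show ?thesis by blast
  next
    case (3 i)
    then have "Rim i \<in> verts (helm n)" "Centre \<in> verts (helm n)" "Rim i \<noteq> Centre"
      by (simp_all add: verts_helm image_iff)
    with 3(2) show ?thesis by blast
  next
    case (4 i)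
    then have "Rim i \<in> verts (helm n)" "Pendant i \<in> verts (helm n)" "Rim i \<noteq> Pendant i"
      by (simp_all add: verts_helm image_iff)
    with 4(2) show ?thesis by blast
  qed
  then show "\<exists>u\<in>verts (helm n). \<exists>v\<in>verts (helm n). u \<noteq> v \<and> e = {u, v}" by blast
qed

lemma finite_nonempty_completion_sizes:
  assumes "simple_graph G"
  shows "finite {card F |c F. chromatic_colouring G c \<and> addable G c F}"
    and "{card F |c F. chromatic_colouring G c \<and> addable G c F} \<noteq> {}"
proof -
  have fin: "finite (verts G)"
    using assms unfolding simple_graph_def by (rule conjunct1)
  have sub: "F \<subseteq> Pow (verts G)" if "addable G c F" for c F
  proof
    fix e assume "e \<in> F"
    moreover have "simple_graph (verts G, edges G \<union> F)"
      using that unfolding addable_def by (elim conjE)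
    ultimately have "\<exists>u\<in>verts G. \<exists>v\<in>verts G. u \<noteq> v \<and> e = {u, v}"
      unfolding simple_graph_def fst_conv snd_conv by (meson UnI2)
    then show "e \<in> Pow (verts G)" by (elim bexE conjE) simp
  qed
  have "{card F |c F. chromatic_colouring G c \<and> addable G c F} \<subseteq> card ` Pow (Pow (verts G))"
  proof
    fix m assume "m \<in> {card F |c F. chromatic_colouring G c \<and> addable G c F}"
    then obtain c F where "m = card F" "addable G c F" by (elim CollectE exE conjE)
    then show "m \<in> card ` Pow (Pow (verts G))" by (intro image_eqI PowI sub)
  qed
  then show "finite {card F |c F. chromatic_colouring G c \<and> addable G c F}"
    by (rule finite_subset) (intro finite_imageI finite_Pow_iff[THEN iffD2] fin)
  obtain f :: "'a \<Rightarrow> nat" where f: "inj_on f (verts G)"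
    using finite_imp_inj_to_nat_seg[OF fin] by (elim exE conjE)
  have "proper_colouring G f"
    unfolding proper_colouring_def
  proof (intro allI impI)
    fix u v assume "{u, v} \<in> edges G"
    with assms have "\<exists>x\<in>verts G. \<exists>y\<in>verts G. x \<noteq> y \<and> {u, v} = {x, y}"
      unfolding simple_graph_def by (elim conjE) (rule bspec)
    then have "u \<in> verts G" "v \<in> verts G" "u \<noteq> v"
      by (elim bexE conjE, auto simp: doubleton_eq_iff)+
    with f show "f u \<noteq> f v" by (simp add: inj_on_eq_iff)
  qed
  then have "\<exists>c. proper_colouring G c \<and> card (c ` verts G) = card (f ` verts G)"
    by (intro exI[of _ f] conjI refl)
  then have "\<exists>c. chromatic_colouring G c"
    unfolding chromatic_colouring_def chromatic_number_def
    by (rule LeastI[where P = "\<lambda>k. \<exists>c. proper_colouring G c \<and> card (c ` verts G) = k"])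
  then obtain c where "chromatic_colouring G c" ..
  moreover have "addable G c {}"
    using assms unfolding addable_def by simp
  ultimately have "card ({} :: 'a set set) \<in> {card F |c F. chromatic_colouring G c \<and> addable G c F}"
    by (intro CollectI exI[of _ c] exI[of _ "{}"] conjI refl)
  then show "{card F |c F. chromatic_colouring G c \<and> addable G c F} \<noteq> {}"
    by (metis empty_iff)
qed

definition N1' :: "nat set" where "N1' = {3 + 6 * i |i. True}"
definition N2' :: "nat set" where "N2' = {5 + 6 * j |j. True}"
definition N3' :: "nat set" where "N3' = {7 + 6 * k |k. True}"

end

theory Submission imports Defs begin

text \<open>
  Fix a proper colouring \<open>c\<close> of a simple graph.  Every edge joins vertices of different colours, so
  the edges that may be added are exactly the remaining bichromatic pairs.  Hence \<open>\<zeta>(G)\<close> is the largest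
  number of bichromatic pairs over all chromatic colourings, minus the number of edges of \<open>G\<close>
  (\<open>chromatic_completion_number_eqI\<close>).

  If \<open>N\<close> vertices are split into \<open>k\<close> colour classes of sizes \<open>a\<close>, then twice the number of
  bichromatic pairs is \<open>N\<^sup>2\<close> minus the sum of the squares \<open>a\<^sup>2\<close>.  Completing the square around
  \<open>q + 1/2\<close> rewrites this as a constant minus the sum of the terms \<open>(a - q) * (a - (q + 1))\<close>
  (\<open>bichromatic_count\<close>).  These terms are nonnegative for integers and vanish exactly when
  \<open>a\<close> is \<open>q\<close> or \<open>q + 1\<close>.  So the maximum is the number of edges of the balanced complete
  \<open>k\<close>-partite graph, and it is attained by any colouring with class sizes \<open>q\<close> and \<open>q + 1\<close>.

  For the helm with \<open>n = 2 * q + 1\<close> the odd rim needs three colours and the centre a fourth, so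
  \<open>k = 4\<close>, while \<open>N = 4 * q + 3\<close>.  A balanced chromatic colouring exists: the rim can use its third
  colour only once, and all but one of the pendant vertices, each of which avoids just one colour, fill
  up the class of that colour and the class of the centre.  The maximum of bichromatic pairs is therefore
  \<open>3 * (q + 1) * (2 * q + 1)\<close>, and subtracting the \<open>3 * n\<close> edges leaves \<open>3 * n * q\<close>, which for \<open>n = 3\<close>
  is \<open>9\<close>.
\<close>

section \<open>Bichromatic pairs and completion\<close>

definition bichromatic_pairs :: "('a \<Rightarrow> nat) \<Rightarrow> 'a set \<Rightarrow> 'a set set" where
  "bichromatic_pairs c V = {{u, v} |u v. u \<in> V \<and> v \<in> V \<and> c u \<noteq> c v}"

lemma finite_bichromatic_pairs:
  assumes "finite V"
  shows "finite (bichromatic_pairs c V)"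
proof (rule finite_subset)
  show "bichromatic_pairs c V \<subseteq> Pow V"
    unfolding bichromatic_pairs_def by blast
qed (use assms in simp)

lemma proper_edges_bichromatic:
  assumes "simple_graph G" and "proper_colouring G c"
  shows "edges G \<subseteq> bichromatic_pairs c (verts G)"
proof
  fix e assume e: "e \<in> edges G"
  then obtain u v where uv: "u \<in> verts G" "v \<in> verts G" "e = {u, v}"
    using assms(1) unfolding simple_graph_def by blast
  with e assms(2) have "c u \<noteq> c v"
    unfolding proper_colouring_def by blast
  with uv show "e \<in> bichromatic_pairs c (verts G)"
    unfolding bichromatic_pairs_def by blast
qed

lemma addable_iff:
  assumes "simple_graph G"
  shows "addable G c F \<longleftrightarrow> F \<subseteq> bichromatic_pairs c (verts G) - edges G"
proof
  assume F: "addable G c F"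
  show "F \<subseteq> bichromatic_pairs c (verts G) - edges G"
  proof
    fix e assume e: "e \<in> F"
    have "simple_graph (verts G, edges G \<union> F)"
      using F unfolding addable_def by blast
    with e have "\<exists>u\<in>verts G. \<exists>v\<in>verts G. u \<noteq> v \<and> e = {u, v}"
      unfolding simple_graph_def fst_conv snd_conv by (meson UnI2)
    then obtain u v where uv: "u \<in> verts G" "v \<in> verts G" "e = {u, v}"
      by blast
    moreover have "c u \<noteq> c v"
      using F e uv(3) unfolding addable_def bad_edge_def by blast
    moreover have "e \<notin> edges G"
      using F e unfolding addable_def by blast
    ultimately show "e \<in> bichromatic_pairs c (verts G) - edges G"
      unfolding bichromatic_pairs_def by blast
  qed
next
  assume F: "F \<subseteq> bichromatic_pairs c (verts G) - edges G"
  have pair: "\<exists>u\<in>verts G. \<exists>v\<in>verts G. c u \<noteq> c v \<and> e = {u, v}" if "e \<in> F" for e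
    using F that unfolding bichromatic_pairs_def by blast
  have "\<exists>u\<in>verts G. \<exists>v\<in>verts G. u \<noteq> v \<and> e = {u, v}" if "e \<in> F" for e
    using pair[OF that] by metis
  with assms have "simple_graph (verts G, edges G \<union> F)"
    unfolding simple_graph_def fst_conv snd_conv by (meson UnE)
  moreover have "\<not> bad_edge c e" if "e \<in> F" for e
    using pair[OF that] unfolding bad_edge_def by (auto simp: doubleton_eq_iff)
  ultimately show "addable G c F"
    unfolding addable_def using F by blast
qed

lemma chromatic_completion_number_eqI:
  assumes G: "simple_graph G"
    and upper: "\<And>c. chromatic_colouring G c \<Longrightarrow> card (bichromatic_pairs c (verts G)) \<le> M"
    and c: "chromatic_colouring G c" "card (bichromatic_pairs c (verts G)) = M"
  shows "chromatic_completion_number G = M - card (edges G)"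
proof -
  have V: "finite (verts G)"
    using G unfolding simple_graph_def by blast
  have rest: "card (bichromatic_pairs d (verts G) - edges G)
      = card (bichromatic_pairs d (verts G)) - card (edges G)"
    if "chromatic_colouring G d" for d
    using that proper_edges_bichromatic[OF G] finite_bichromatic_pairs[OF V]
    unfolding chromatic_colouring_def by (meson card_Diff_subset finite_subset)
  show ?thesis
    unfolding chromatic_completion_number_def
  proof (rule Max_eqI)
    show "finite {card F |c F. chromatic_colouring G c \<and> addable G c F}"
      by (rule finite_nonempty_completion_sizes(1)[OF G])
  next
    fix m assume "m \<in> {card F |c F. chromatic_colouring G c \<and> addable G c F}"
    then obtain d F where d: "chromatic_colouring G d" and F: "addable G d F" "m = card F"
      by blast
    have "m \<le> card (bichromatic_pairs d (verts G) - edges G)"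
      using F unfolding addable_iff[OF G]
      by (simp add: card_mono finite_bichromatic_pairs[OF V])
    also have "\<dots> \<le> M - card (edges G)"
      unfolding rest[OF d] by (rule diff_le_mono[OF upper[OF d]])
    finally show "m \<le> M - card (edges G)" .
  next
    have "addable G c (bichromatic_pairs c (verts G) - edges G)"
      unfolding addable_iff[OF G] by simp
    with rest[OF c(1)] c
    show "M - card (edges G) \<in> {card F |c F. chromatic_colouring G c \<and> addable G c F}"
      by (intro CollectI exI[of _ c] exI[of _ "bichromatic_pairs c (verts G) - edges G"]) simp
  qed
qed

section \<open>Counting bichromatic pairs by class sizes\<close>

text \<open>
  Colours are natural numbers, so a bichromatic pair has a unique listing with increasing colours.
  This avoids dividing the ordered pairs by two.
\<close>
lemma card_bichromatic_pairs_ordered: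
  "card (bichromatic_pairs c V) = card {(u, v). u \<in> V \<and> v \<in> V \<and> c u < c v}"
proof -
  have "bichromatic_pairs c V = (\<lambda>(u, v). {u, v}) ` {(u, v). u \<in> V \<and> v \<in> V \<and> c u < c v}"
    (is "?L = ?R")
  proof
    show "?L \<subseteq> ?R"
    proof
      fix e assume "e \<in> ?L"
      then obtain u v where uv: "u \<in> V" "v \<in> V" "e = {u, v}" "c u \<noteq> c v"
        unfolding bichromatic_pairs_def by blast
      then consider "c u < c v" | "c v < c u"
        by linarith
      then show "e \<in> ?R"
      proof cases
        case 1
        with uv show ?thesis by (intro image_eqI[where x = "(u, v)"]) auto
      next
        case 2
        with uv show ?thesis by (intro image_eqI[where x = "(v, u)"]) auto
      qed
    qed
    show "?R \<subseteq> ?L"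
      unfolding bichromatic_pairs_def by fastforce
  qed
  moreover have "inj_on (\<lambda>(u, v). {u, v}) {(u, v). u \<in> V \<and> v \<in> V \<and> c u < c v}"
    by (auto simp: inj_on_def doubleton_eq_iff)
  ultimately show ?thesis
    by (simp add: card_image)
qed

lemma card_square_bichromatic:
  assumes "finite V"
  shows "(card V)\<^sup>2 = 2 * card (bichromatic_pairs c V) + (\<Sum>k\<in>c ` V. (card {v \<in> V. c v = k})\<^sup>2)"
proof -
  let ?lt = "{(u, v). u \<in> V \<and> v \<in> V \<and> c u < c v}"
  let ?gt = "{(u, v). u \<in> V \<and> v \<in> V \<and> c v < c u}"
  let ?class = "\<lambda>k. {v \<in> V. c v = k}"
  let ?eq = "\<Union>k\<in>c ` V. ?class k \<times> ?class k"
  have split: "V \<times> V = (?lt \<union> ?gt) \<union> ?eq"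
    by (auto elim: linorder_neqE_nat)
  have "finite (V \<times> V)"
    using assms by simp
  then have fin: "finite ?lt" "finite ?gt" "finite ?eq"
    by (auto elim!: finite_subset[rotated])
  have "?gt = prod.swap ` ?lt"
    by (auto simp: image_iff)
  then have gt: "card ?gt = card ?lt"
    by (simp add: card_image)
  have eq: "card ?eq = (\<Sum>k\<in>c ` V. (card (?class k))\<^sup>2)"
    using assms by (subst card_UN_disjoint) (auto simp: card_cartesian_product power2_eq_square)
  have "(card V)\<^sup>2 = card (V \<times> V)"
    by (simp add: card_cartesian_product power2_eq_square)
  also have "\<dots> = card (?lt \<union> ?gt) + card ?eq"
    unfolding split by (rule card_Un_disjoint) (use fin in auto)
  also have "card (?lt \<union> ?gt) = card ?lt + card ?gt"
    by (rule card_Un_disjoint) (use fin in auto)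
  finally show ?thesis
    unfolding gt eq card_bichromatic_pairs_ordered by simp
qed

text \<open>
  The number \<open>q\<close> is free here.  When \<open>q\<close> is the integer part of the average class size, the sum on
  the left measures how far the colouring is from a balanced one.
\<close>
lemma bichromatic_count:
  fixes q :: int
  assumes "finite V"
  shows "2 * int (card (bichromatic_pairs c V))
      + (\<Sum>k\<in>c ` V. (int (card {v \<in> V. c v = k}) - q) * (int (card {v \<in> V. c v = k}) - (q + 1)))
    = (int (card V))\<^sup>2 - (2 * q + 1) * int (card V) + int (card (c ` V)) * (q * (q + 1))"
proof -
  let ?a = "\<lambda>k. int (card {v \<in> V. c v = k})"
  have "card V = (\<Sum>k\<in>c ` V. card {v \<in> V. c v = k})"
    using sum.image_gen[OF assms, of "\<lambda>_. 1 :: nat" c] by simp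
  then have N: "int (card V) = (\<Sum>k\<in>c ` V. ?a k)"
    by simp
  have "int ((card V)\<^sup>2) = int (2 * card (bichromatic_pairs c V)
      + (\<Sum>k\<in>c ` V. (card {v \<in> V. c v = k})\<^sup>2))"
    by (simp only: card_square_bichromatic[OF assms, of c])
  then have sq: "(int (card V))\<^sup>2 = 2 * int (card (bichromatic_pairs c V)) + (\<Sum>k\<in>c ` V. (?a k)\<^sup>2)"
    by simp
  have "(\<Sum>k\<in>c ` V. (?a k - q) * (?a k - (q + 1)))
      = (\<Sum>k\<in>c ` V. (?a k)\<^sup>2 - (2 * q + 1) * ?a k + q * (q + 1))"
    by (rule sum.cong) (simp_all add: algebra_simps power2_eq_square)
  also have "\<dots> = (\<Sum>k\<in>c ` V. (?a k)\<^sup>2) - (2 * q + 1) * int (card V)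
      + int (card (c ` V)) * (q * (q + 1))"
    unfolding N by (simp add: sum.distrib sum_subtractf sum_distrib_left)
  finally show ?thesis
    using sq by linarith
qed

lemma consecutive_product_nonneg:
  fixes a q :: int
  shows "0 \<le> (a - q) * (a - (q + 1))"
proof (cases "a \<le> q")
  case True
  then show ?thesis by (intro mult_nonpos_nonpos) auto
next
  case False
  then show ?thesis by (intro mult_nonneg_nonneg) auto
qed

section \<open>The chromatic number of a helm with odd rim\<close>

text \<open>With two colours the colours would have to alternate along the cycle, so an odd cycle would not close up.\<close>
lemma odd_cycle_three_colours:
  fixes f :: "nat \<Rightarrow> 'a"
  assumes step: "\<And>i. 1 \<le> i \<Longrightarrow> i < n \<Longrightarrow> f i \<noteq> f (i + 1)"
    and close: "f n \<noteq> f 1" and "odd n"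
  shows "3 \<le> card (f ` {1..n})"
proof (rule ccontr)
  assume few: "\<not> 3 \<le> card (f ` {1..n})"
  have two: "f i = f 1" if "1 \<le> i" "i \<le> n" "1 \<le> j" "j \<le> n" "f i \<noteq> f j" "f j \<noteq> f 1" for i j
  proof (rule ccontr)
    assume "f i \<noteq> f 1"
    with that have "card {f 1, f i, f j} = 3"
      by auto
    moreover have "{f 1, f i, f j} \<subseteq> f ` {1..n}"
      using that by auto
    ultimately show False
      using few card_mono[of "f ` {1..n}" "{f 1, f i, f j}"] by simp
  qed
  have "i \<le> n \<longrightarrow> (f i = f 1 \<longleftrightarrow> odd i)" if "1 \<le> i" for i
    using that
  proof (induction i rule: nat_induct_at_least)
    case base
    then show ?case by simp
  next
    case (Suc i)
    show ?case
    proof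
      assume i: "Suc i \<le> n"
      with Suc have IH: "f i = f 1 \<longleftrightarrow> odd i" and ne: "f (Suc i) \<noteq> f i"
        using step[of i] by auto
      show "f (Suc i) = f 1 \<longleftrightarrow> odd (Suc i)"
        using IH ne two[of "Suc i" i] i Suc.hyps by auto
    qed
  qed
  moreover have "1 \<le> n"
    using \<open>odd n\<close> by (cases n) auto
  ultimately show False
    using close \<open>odd n\<close> by blast
qed

lemma helm_proper_card_ge:
  assumes "odd n" and c: "proper_colouring (helm n) c"
  shows "4 \<le> card (c ` verts (helm n))"
proof -
  let ?R = "(c \<circ> Rim) ` {1..n}"
  have edge: "c u \<noteq> c v" if "{u, v} \<in> edges (helm n)" for u v
    using c that unfolding proper_colouring_def by blast
  have "3 \<le> card ?R"
  proof (rule odd_cycle_three_colours)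
    show "(c \<circ> Rim) i \<noteq> (c \<circ> Rim) (i + 1)" if "1 \<le> i" "i < n" for i
      unfolding comp_def by (rule edge) (use that in \<open>unfold edges_helm, blast\<close>)
    show "(c \<circ> Rim) n \<noteq> (c \<circ> Rim) 1"
      unfolding comp_def by (rule edge) (unfold edges_helm, blast)
  qed fact
  moreover have "c Centre \<notin> ?R"
  proof
    assume "c Centre \<in> ?R"
    then obtain i where i: "i \<in> {1..n}" "c Centre = c (Rim i)"
      by auto
    have "c (Rim i) \<noteq> c Centre"
      by (rule edge) (use i in \<open>unfold edges_helm, blast\<close>)
    with i show False by simp
  qed
  ultimately have "4 \<le> card (insert (c Centre) ?R)"
    by simp
  also have "\<dots> \<le> card (c ` verts (helm n))"
    by (rule card_mono) (auto simp: verts_helm)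
  finally show ?thesis .
qed

text \<open>
  The rim alternates between the colours 1 and 2 and closes up with a single 3.  The pendant vertices
  next to the alternating part are free to take the colours 3 and 0, which are used only once on
  the wheel.  The last pendant vertex gets 1 (2 would do as well), so just one class is smaller by one.
\<close>
fun balanced_helm_colouring :: "nat \<Rightarrow> helm_vertex \<Rightarrow> nat" where
  "balanced_helm_colouring n Centre = 0"
| "balanced_helm_colouring n (Rim i) = (if i = n then 3 else if odd i then 1 else 2)"
| "balanced_helm_colouring n (Pendant i) = (if i = n then 1 else if odd i then 3 else 0)"

lemma balanced_helm_colouring_proper:
  assumes "n \<ge> 3" and "odd n"
  shows "proper_colouring (helm n) (balanced_helm_colouring n)"
  unfolding proper_colouring_def edges_helm
  using assms by (auto simp: doubleton_eq_iff split: if_splits)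

lemma balanced_helm_colouring_image:
  assumes "n \<ge> 3"
  shows "balanced_helm_colouring n ` verts (helm n) = {0, 1, 2, 3}"
proof
  show "balanced_helm_colouring n ` verts (helm n) \<subseteq> {0, 1, 2, 3}"
    by (auto simp: verts_helm split: if_splits)
  have "Centre \<in> verts (helm n)" "Rim 1 \<in> verts (helm n)" "Rim 2 \<in> verts (helm n)"
    "Rim n \<in> verts (helm n)"
    using assms by (auto simp: verts_helm)
  then have "balanced_helm_colouring n ` {Centre, Rim 1, Rim 2, Rim n}
      \<subseteq> balanced_helm_colouring n ` verts (helm n)"
    by (intro image_mono) simp
  with assms show "{0, 1, 2, 3} \<subseteq> balanced_helm_colouring n ` verts (helm n)"
    by auto
qed

lemma helm_chromatic_number:
  assumes "n \<ge> 3" and "odd n"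
  shows "chromatic_number (helm n) = 4"
  unfolding chromatic_number_def
proof (rule Least_equality)
  show "\<exists>c. proper_colouring (helm n) c \<and> card (c ` verts (helm n)) = 4"
    using balanced_helm_colouring_proper[OF assms] balanced_helm_colouring_image[OF assms(1)]
    by (intro exI[of _ "balanced_helm_colouring n"]) simp
next
  fix k assume "\<exists>c. proper_colouring (helm n) c \<and> card (c ` verts (helm n)) = k"
  then show "4 \<le> k"
    using helm_proper_card_ge[OF assms(2)] by blast
qed

section \<open>Sizes in a helm\<close>

lemma card_verts_helm: "card (verts (helm n)) = 2 * n + 1"
proof -
  have "card (Rim ` {1..n} \<union> Pendant ` {1..n}) = n + n"
    by (subst card_Un_disjoint) (auto simp: card_image inj_on_def)
  moreover have "Centre \<notin> Rim ` {1..n} \<union> Pendant ` {1..n}"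
    by auto
  ultimately show ?thesis
    unfolding verts_helm by simp
qed

text \<open>For \<open>n = 2\<close> the closing edge of the cycle would coincide with another rim edge.\<close>
lemma card_edges_helm:
  assumes "n \<ge> 3"
  shows "card (edges (helm n)) = 3 * n"
proof -
  let ?path = "(\<lambda>i. {Rim i, Rim (i + 1)}) ` {1..<n}"
  let ?spokes = "(\<lambda>i. {Rim i, Centre}) ` {1..n}"
  let ?pendants = "(\<lambda>i. {Rim i, Pendant i}) ` {1..n}"
  have E: "edges (helm n) = insert {Rim n, Rim 1} ?path \<union> (?spokes \<union> ?pendants)"
    unfolding edges_helm by auto
  have "{Rim n, Rim 1} \<notin> ?path"
  proof
    assume "{Rim n, Rim 1} \<in> ?path"
    then obtain i where "{Rim n, Rim 1} = {Rim i, Rim (i + 1)}" "i \<in> {1..<n}"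
      by (rule imageE)
    then have "n = i + 1" "1 = i"
      unfolding doubleton_eq_iff helm_vertex.inject atLeastLessThan_iff by linarith+
    with assms show False
      by linarith
  qed
  moreover have "card ?path = n - 1"
    by (subst card_image) (auto simp: inj_on_def doubleton_eq_iff)
  ultimately have cycle: "card (insert {Rim n, Rim 1} ?path) = n"
    using assms by simp
  have "card ?spokes = n" "card ?pendants = n"
    by (subst card_image; auto simp: inj_on_def doubleton_eq_iff)+
  then have others: "card (?spokes \<union> ?pendants) = n + n"
    by (subst card_Un_disjoint) (auto simp: doubleton_eq_iff)
  have "insert {Rim n, Rim 1} ?path \<inter> (?spokes \<union> ?pendants) = {}"
    by (auto simp: doubleton_eq_iff)
  then have "card (edges (helm n)) = n + (n + n)"
    unfolding E by (subst card_Un_disjoint) (simp_all only: cycle others finite_Un finite_insert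
      finite_imageI finite_atLeastLessThan finite_atLeastAtMost simp_thms)
  then show ?thesis
    by simp
qed

lemma card_odd_even_upto:
  "card {i \<in> {1..2 * q}. odd i} = q" "card {i \<in> {1..2 * q}. even i} = (q :: nat)"
proof -
  have "{i \<in> {1..2 * q}. odd i} = (\<lambda>j. 2 * j + 1) ` {..<q}"
    by (auto elim!: oddE)
  then show "card {i \<in> {1..2 * q}. odd i} = q"
    by (simp add: card_image inj_on_def)
  have "{i \<in> {1..2 * q}. even i} = (\<lambda>j. 2 * j) ` {1..q}"
    by (auto elim!: evenE)
  then show "card {i \<in> {1..2 * q}. even i} = q"
    by (simp add: card_image inj_on_def)
qed

lemma balanced_helm_colouring_class_size:
  assumes n: "n = 2 * q + 1" and k: "k \<in> {0, 1, 2, 3}"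
  shows "card {v \<in> verts (helm n). balanced_helm_colouring n v = k} = (if k = 2 then q else q + 1)"
proof -
  let ?odd = "{i \<in> {1..2 * q}. odd i}" and ?even = "{i \<in> {1..2 * q}. even i}"
  let ?class = "\<lambda>k. {v \<in> verts (helm n). balanced_helm_colouring n v = k}"
  have img: "card (f ` ?odd) = q" "card (f ` ?even) = q" if "inj f" for f :: "nat \<Rightarrow> helm_vertex"
    unfolding card_image[OF inj_on_subset[OF that subset_UNIV]] by (fact card_odd_even_upto)+
  have inj: "inj Rim" "inj Pendant"
    by (auto simp: inj_def)
  have mem: "Centre \<in> verts (helm n)" "Rim i \<in> verts (helm n) \<longleftrightarrow> i = n \<or> i \<in> {1..2 * q}"
    "Pendant i \<in> verts (helm n) \<longleftrightarrow> i = n \<or> i \<in> {1..2 * q}" "n \<notin> {1..2 * q}" for i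
    unfolding verts_helm n by auto
  have "?class 0 = insert Centre (Pendant ` ?even)" "?class 1 = insert (Pendant n) (Rim ` ?odd)"
    "?class 2 = Rim ` ?even" "?class 3 = insert (Rim n) (Pendant ` ?odd)"
    by ((rule set_eqI, rename_tac v, case_tac v);
        use mem in \<open>auto simp: inj_image_mem_iff[OF inj(1)] inj_image_mem_iff[OF inj(2)]
          simp del: atLeastAtMost_iff One_nat_def split: if_splits\<close>)+
  moreover have "Centre \<notin> Pendant ` ?even" "Pendant n \<notin> Rim ` ?odd" "Rim n \<notin> Pendant ` ?odd"
    by auto
  ultimately have "card (?class 0) = q + 1" "card (?class 1) = q + 1" "card (?class 2) = q"
    "card (?class 3) = q + 1"
    by (simp_all add: img inj del: atLeastAtMost_iff One_nat_def)
  with k show ?thesis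
    by auto
qed

section \<open>The chromatic completion number\<close>

theorem helm_chromatic_completion_number:
  assumes n: "n = 2 * q + 1" and q: "q \<ge> 1"
  shows "chromatic_completion_number (helm n) = 3 * n * q"
proof -
  let ?V = "verts (helm n)" and ?b = "balanced_helm_colouring n"
  have n3: "n \<ge> 3" and odd: "odd n"
    using n q by auto
  have fin: "finite ?V"
    by (simp add: verts_helm)
  define excess where "excess c = (\<Sum>k\<in>c ` ?V. (int (card {v \<in> ?V. c v = k}) - int q)
      * (int (card {v \<in> ?V. c v = k}) - (int q + 1)))" for c :: "helm_vertex \<Rightarrow> nat"
  have count: "2 * int (card (bichromatic_pairs c ?V)) + excess c = 2 * int (3 * (q + 1) * n)"
    if "card (c ` ?V) = 4" for c
    using bichromatic_count[OF fin, of c "int q"] that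
    unfolding excess_def card_verts_helm n by (simp add: algebra_simps power2_eq_square)
  have b: "chromatic_colouring (helm n) ?b"
    unfolding chromatic_colouring_def helm_chromatic_number[OF n3 odd]
      balanced_helm_colouring_image[OF n3]
    using balanced_helm_colouring_proper[OF n3 odd] by simp
  have "excess ?b = 0"
    unfolding excess_def balanced_helm_colouring_image[OF n3]
  proof (rule sum.neutral, rule ballI)
    fix k :: nat assume "k \<in> {0, 1, 2, 3}"
    then show "(int (card {v \<in> ?V. ?b v = k}) - int q)
        * (int (card {v \<in> ?V. ?b v = k}) - (int q + 1)) = 0"
      unfolding balanced_helm_colouring_class_size[OF n \<open>k \<in> {0, 1, 2, 3}\<close>] by simp
  qed
  moreover have "card (?b ` ?V) = 4"
    unfolding balanced_helm_colouring_image[OF n3] by simp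
  ultimately have "card (bichromatic_pairs ?b ?V) = 3 * (q + 1) * n"
    using count[of ?b] by linarith
  moreover have "card (bichromatic_pairs c ?V) \<le> 3 * (q + 1) * n"
    if "chromatic_colouring (helm n) c" for c
  proof -
    have "excess c \<ge> 0"
      unfolding excess_def by (intro sum_nonneg consecutive_product_nonneg)
    moreover have "card (c ` ?V) = 4"
      using that unfolding chromatic_colouring_def helm_chromatic_number[OF n3 odd] by blast
    ultimately show ?thesis
      using count[of c] by linarith
  qed
  ultimately have "chromatic_completion_number (helm n) = 3 * (q + 1) * n - card (edges (helm n))"
    using b by (intro chromatic_completion_number_eqI simple_graph_helm[OF n3])
  then show ?thesis
    unfolding card_edges_helm[OF n3] by (simp add: algebra_simps)
qed

lemma odd_residue_classes:
  fixes n :: nat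
  assumes "n \<ge> 3" and "odd n"
  shows "n \<in> N1' \<or> n \<in> N2' \<or> n \<in> N3'"
proof -
  have "\<exists>i. n = 3 + 6 * i \<or> n = 5 + 6 * i \<or> n = 7 + 6 * i"
    using assms by presburger
  then show ?thesis
    unfolding N1'_def N2'_def N3'_def by blast
qed

theorem proposition2p10:
  fixes n :: nat
  assumes "n \<ge> 3" and "odd n"
  shows "(n = 3 \<or> n \<in> N1' - {3} \<or> n \<in> N2' \<or> n \<in> N3')
    \<and> (n = 3 \<longrightarrow> chromatic_completion_number (helm n) = 9)
    \<and> (n \<in> N1' - {3} \<or> n \<in> N2' \<or> n \<in> N3' \<longrightarrow>
         real (chromatic_completion_number (helm n)) = 3 * real n * (real n - 1) / 2)"
proof -
  obtain q where n: "n = 2 * q + 1"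
    using assms(2) by (rule oddE)
  with assms(1) have zeta: "chromatic_completion_number (helm n) = 3 * n * q"
    by (intro helm_chromatic_completion_number) simp_all
  have "real (chromatic_completion_number (helm n)) = 3 * real n * (real n - 1) / 2"
    unfolding zeta by (simp add: n)
  moreover have "chromatic_completion_number (helm n) = 9" if "n = 3"
    using zeta n that by simp
  moreover have "n = 3 \<or> n \<in> N1' - {3} \<or> n \<in> N2' \<or> n \<in> N3'"
    using odd_residue_classes[OF assms] by blast
  ultimately show ?thesis
    by blast
qed

end
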